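(* For $n\ge1$ let $\Gamma_n$ be the Schreier graph at level $n$ of the Hanoi Towers group $H^{(3)}$ on 3 pegs. For $1\le p<\infty$ the $p$-spectral gap of the graphs $\Gamma_n$ converges exponentially to zero. More precisely, for every $1\le p<\infty$ there exists a constant $C>0$ (depending on $p$) such that for every $n\in\mathbb{N}$, $n\ge 1$, $$\lambda_1^{(p)}(\Gamma_n)\le C\,2^{-np}.$$
   Context: Hanoi Towers group: on finite words over the alphabet $\{0,1,2\}$ (the vertices of the rooted ternary tree), for $i\ne j$ in $\{0,1,2\}$ and $x\in\{0,1,2\}\setminus\{i,j\}$ define recursively the automorphism $a_{(ij)}$ by $a_{(ij)}(iw)=jw$, $a_{(ij)}(jw)=iw$, $a_{(ij)}(xw)=x\,a_{(ij)}(w)$ for every word $w$, with the empty word fixed. Put $a=a_{(01)}$, $b=a_{(02)}$, $c=a_{(12)}$ (each an involution); $H^{(3)}$ is the group they generate. $\Gamma_n$ is the Schreier graph of the stabilizer $P_n=\mathrm{st}_{H^{(3)}}(1^n)$ with respect to $\{a,b,c\}$; equivalently, since the action on each level is transitive, its vertex set is the set of $3^n$ words of length $n$ over $\{0,1,2\}$, with $w$ joined to $s(w)$ by an edge for each $s\in\{a,b,c\}$ (giving a loop when $s(w)=w$). $p$-spectral gap: for a finite connected graph $\Gamma=(V,E)$, write $x\sim y$ if $x,y$ are joined by an edge and let $\omega(x,y)$ be the number of edges joining them. For $1\le p<\infty$, $$\lambda_1^{(p)}(\Gamma)=\inf_f \frac{\sum_{x\in V}\sum_{y\sim x}|f(x)-f(y)|^p\,\omega(x,y)}{\inf_{\alpha\in\mathbb{R}}\sum_{x\in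 V}|f(x)-\alpha|^p},$$ the infimum being over all non-constant $f:V\to\mathbb{R}$ (in $\sum_{y\sim x}$ each neighbouring vertex $y$ is counted once). *)

theory Defs
  imports Complex_Main "HOL-Library.Numeral_Type" "HOL-Algebra.Group_Action" "HOL-Algebra.Elementary_Groups"
begin

section \<open>The Hanoi Towers group\<close>

text \<open>The alphabet is the three-element type \<open>3\<close> of numerals \<open>0, 1, 2\<close>; the vertices of the
  rooted ternary tree are the lists over it.\<close>

primrec hanoi_move :: "3 \<Rightarrow> 3 \<Rightarrow> 3 list \<Rightarrow> 3 list" where
  "hanoi_move i j [] = []"
| "hanoi_move i j (x # w) =
     (if x = i then j # w else if x = j then i # w else x # hanoi_move i j w)"

definition hanoi_gens :: "(3 list \<Rightarrow> 3 list) set" where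
  "hanoi_gens = {hanoi_move 0 1, hanoi_move 0 2, hanoi_move 1 2}"

lemma hanoi_move_involution: "hanoi_move i j (hanoi_move i j w) = w"
  by (induction w) auto

lemma hanoi_gens_in_BijGroup: "hanoi_gens \<subseteq> carrier (BijGroup UNIV)"
proof -
  have "bij (hanoi_move i j)" for i j
    by (rule involuntory_imp_bij) (rule hanoi_move_involution)
  then show ?thesis
    by (auto simp: hanoi_gens_def BijGroup_def Bij_def)
qed

lemma card_hanoi_gens: "card hanoi_gens = 3"
proof -
  have "hanoi_move 0 1 [0] \<noteq> hanoi_move 0 2 [0]" "hanoi_move 0 1 [0] \<noteq> hanoi_move 1 2 [0]"
       "hanoi_move 0 2 [0] \<noteq> hanoi_move 1 2 [0]"
    by simp_all
  then have "hanoi_move 0 1 \<noteq> hanoi_move 0 2" "hanoi_move 0 1 \<noteq> hanoi_move 1 2"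
       "hanoi_move 0 2 \<noteq> hanoi_move 1 2"
    by metis+
  then show ?thesis
    by (simp add: hanoi_gens_def)
qed

text \<open>\<^const>\<open>subgroup_generated\<close> intersects its second argument with the carrier, which has no
  effect here by \<open>hanoi_gens_in_BijGroup\<close>. The group operation is composition of functions.\<close>

definition hanoi_group :: "(3 list \<Rightarrow> 3 list) monoid" where
  "hanoi_group = subgroup_generated (BijGroup UNIV) hanoi_gens"

section \<open>Schreier graphs and the p-spectral gap\<close>

text \<open>An undirected graph with loops and multiple edges; \<open>edge_mult \<Gamma> x y\<close> is the number
  of edges joining \<open>x\<close> and \<open>y\<close>.\<close>

record 'v multigraph =
  vertices :: "'v set"
  edge_mult :: "'v \<Rightarrow> 'v \<Rightarrow> nat"

text \<open>For a set \<open>S\<close> of involutions the edge labelled \<open>s\<close> at \<open>P g\<close> and the one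
  labelled \<open>s\<close> at \<open>P g s\<close> are the same undirected edge, so the multiplicity below counts each
  edge once and is symmetric.\<close>

definition schreier_graph ::
    "('a, 'm) monoid_scheme \<Rightarrow> 'a set \<Rightarrow> 'a set \<Rightarrow> 'a set multigraph" where
  "schreier_graph G P S =
     \<lparr> vertices = rcosets\<^bsub>G\<^esub> P,
       edge_mult = (\<lambda>A B. card {s \<in> S. A #>\<^bsub>G\<^esub> s = B}) \<rparr>"

text \<open>With composition as product, \<open>P g \<mapsto> g\<^sup>-\<^sup>1(1\<^sup>n)\<close> identifies the right cosets of the
  stabilizer \<open>P\<close> of \<open>1\<^sup>n\<close> with the orbit of \<open>1\<^sup>n\<close>, and carries the edge between \<open>P g\<close> and
  \<open>P g s\<close> to an edge between \<open>w\<close> and \<open>s(w)\<close>, since \<open>s\<close> is an involution.\<close>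

definition hanoi_schreier_graph :: "nat \<Rightarrow> (3 list \<Rightarrow> 3 list) set multigraph" where
  "hanoi_schreier_graph n =
     schreier_graph hanoi_group (stabilizer hanoi_group (\<lambda>g. g) (replicate n 1)) hanoi_gens"

definition p_spectral_gap :: "real \<Rightarrow> 'v multigraph \<Rightarrow> real" where
  "p_spectral_gap p \<Gamma> =
     (INF f \<in> {f :: 'v \<Rightarrow> real. \<exists>x \<in> vertices \<Gamma>. \<exists>y \<in> vertices \<Gamma>. f x \<noteq> f y}.
        (\<Sum>x \<in> vertices \<Gamma>. \<Sum>y | y \<in> vertices \<Gamma> \<and> edge_mult \<Gamma> x y > 0.
            \<bar>f x - f y\<bar> powr p * real (edge_mult \<Gamma> x y))
        / (INF \<alpha>. \<Sum>x \<in> vertices \<Gamma>. \<bar>f x - \<alpha>\<bar> powr p))"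

end

theory Submission imports Defs begin

text \<open>
  The gap is an infimum of Rayleigh quotients, so one good test function suffices. Call the largest
  disk the one described by the last letter of a word; then \<open>\<Gamma>\<^sub>n\<close> has diameter of order
  \<open>2\<^sup>n\<close>, and the test function is the distance to a corner, that is, the number of
  moves needed to bring the whole tower to the peg 0. It has a closed recursion in the letters
  (\<open>corner_dist\<close>), read off from the usual solution of the puzzle: if the largest disk is not on its
  goal, all smaller disks go to the third peg first and
  \<open>2\<^sup>m\<close> moves, \<open>m\<close> being the number of smaller disks, can be charged to the largest one.

  Along every edge this function changes by at most 1 (\<open>corner_dist_hanoi_move\<close>), so its
  energy is at most three times the number of vertices. It is also far from every constant
  \<open>\<alpha>\<close>: the words whose largest disk is on peg 0 and those whose largest disk is on peg 1
  can be matched such that the values in each pair differ by exactly \<open>2\<^bsup>n-1\<^esup>\<close>, so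
  in every pair one value is at least \<open>2\<^bsup>n-2\<^esup>\<close> away from \<open>\<alpha>\<close>
  (\<open>corner_dist_deviation\<close>). This gives a denominator of at least
  \<open>3\<^bsup>n-1\<^esup> 2\<^bsup>(n-2)p\<^esup>\<close>, hence a quotient of at most
  \<open>9 \<cdot> 4\<^sup>p 2\<^bsup>-np\<^esup>\<close>.

  The vertices of \<open>\<Gamma>\<^sub>n\<close> are cosets. The bijection of the orbit-stabilizer theorem turns them into
  the orbit of \<open>1\<^sup>n\<close>, and this orbit contains every word of length \<open>n\<close> because the
  puzzle can be solved from any position (\<open>hanoi_orbit\<close>); the lower bound for the denominator
  depends on having all words.
\<close>

section \<open>Upper bounds for the spectral gap of a Schreier graph\<close>

lemma p_spectral_gap_le:
  fixes f :: "'v \<Rightarrow> real" and \<Gamma> :: "'v multigraph"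
  assumes D: "0 < D"
    and energy: "(\<Sum>x \<in> vertices \<Gamma>. \<Sum>y | y \<in> vertices \<Gamma> \<and> edge_mult \<Gamma> x y > 0.
                    \<bar>f x - f y\<bar> powr p * real (edge_mult \<Gamma> x y)) \<le> N"
    and deviation: "\<And>\<alpha>. D \<le> (\<Sum>x \<in> vertices \<Gamma>. \<bar>f x - \<alpha>\<bar> powr p)"
  shows "p_spectral_gap p \<Gamma> \<le> N / D"
proof -
  define num where "num f = (\<Sum>x \<in> vertices \<Gamma>. \<Sum>y | y \<in> vertices \<Gamma> \<and> edge_mult \<Gamma> x y > 0.
      \<bar>f x - f y\<bar> powr p * real (edge_mult \<Gamma> x y))" for f :: "'v \<Rightarrow> real"
  define den where "den f = (INF \<alpha>. \<Sum>x \<in> vertices \<Gamma>. \<bar>f x - \<alpha>\<bar> powr p)" for f :: "'v \<Rightarrow> real"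
  have num_nonneg: "0 \<le> num g" for g
    unfolding num_def by (intro sum_nonneg) auto
  have den_nonneg: "0 \<le> den g" for g
    unfolding den_def by (intro cINF_greatest sum_nonneg) auto
  have "D \<le> den f"
    unfolding den_def by (intro cINF_greatest deviation) auto
  have nonconstant: "\<exists>x \<in> vertices \<Gamma>. \<exists>y \<in> vertices \<Gamma>. f x \<noteq> f y"
  proof (rule ccontr)
    assume "\<not> ?thesis"
    then obtain c where "\<forall>x \<in> vertices \<Gamma>. f x = c"
      by metis
    then have "(\<Sum>x \<in> vertices \<Gamma>. \<bar>f x - c\<bar> powr p) = 0"
      by simp
    with deviation[of c] D show False
      by simp
  qed
  (* Every Rayleigh quotient is nonnegative, so the infimum is a lower bound of all of them. *)
  have "p_spectral_gap p \<Gamma> \<le> num f / den f"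
    unfolding p_spectral_gap_def num_def[symmetric] den_def[symmetric]
    using nonconstant num_nonneg den_nonneg
    by (intro cINF_lower bdd_belowI2[where m = 0]) auto
  also have "\<dots> \<le> N / D"
    using num_nonneg[of f] energy \<open>D \<le> den f\<close> D by (intro frac_le) (auto simp: num_def)
  finally show ?thesis .
qed

text \<open>The bijection between cosets and orbit points inverts group elements, so right translation of
  a coset by \<open>s\<close> becomes the action of the inverse of \<open>s\<close> on the orbit.\<close>

lemma (in group_action) orb_stab_fun_r_coset:
  assumes x: "x \<in> E" and A: "A \<in> rcosets (stabilizer G \<phi> x)" and s: "s \<in> carrier G"
  shows "orb_stab_fun G \<phi> (A #> s) x = \<phi> (inv s) (orb_stab_fun G \<phi> A x)"
proof -
  interpret group G
    using group_hom group_hom.axioms(1) by auto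
  let ?P = "stabilizer G \<phi> x"
  interpret P: subgroup ?P G
    using x by (rule stabilizer_subgroup)
  obtain a where a: "a \<in> carrier G" "A = ?P #> a"
    using A unfolding RCOSETS_def by auto
  have "a \<in> A"
    using a by (simp add: rcos_self P.subgroup_axioms)
  have As: "A #> s = ?P #> (a \<otimes> s)"
    using a s by (simp add: coset_mult_assoc P.subset)
  then have As_coset: "A #> s \<in> rcosets ?P" and "a \<otimes> s \<in> A #> s"
    using a s by (auto intro: rcosetsI rcos_self P.subgroup_axioms simp: P.subset)
  then have "orb_stab_fun G \<phi> (A #> s) x = \<phi> (inv (a \<otimes> s)) x"
    unfolding orb_stab_fun_def using orbit_stab_fun_is_well_defined1[OF x] by blast
  also have "\<dots> = \<phi> (inv s) (\<phi> (inv a) x)"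
    using x a s by (simp add: inv_mult_group composition_rule)
  also have "\<phi> (inv a) x = orb_stab_fun G \<phi> A x"
    unfolding orb_stab_fun_def using orbit_stab_fun_is_well_defined1[OF x A \<open>a \<in> A\<close>] by simp
  finally show ?thesis .
qed

text \<open>Each generator contributes one directed edge at each vertex, also when several of them lead to
  the same neighbour or form a loop. So a function on the orbit that varies by at most \<open>L\<close> along
  the generators has energy at most \<open>L\<^sup>p\<close> times the number of pairs of an orbit point and a
  generator.\<close>

lemma (in group_action) schreier_p_spectral_gap_le:
  fixes F :: "'c \<Rightarrow> real"
  assumes x: "x \<in> E" and orbit: "finite (orbit G \<phi> x)"
    and S: "S \<subseteq> carrier G" "finite S"
    and p: "0 \<le> p" and D: "0 < D"
    and lipschitz: "\<And>s y. s \<in> S \<Longrightarrow> y \<in> orbit G \<phi> x \<Longrightarrow> \<bar>F (\<phi> (inv s) y) - F y\<bar> \<le> L"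
    and deviation: "\<And>\<alpha>. D \<le> (\<Sum>y \<in> orbit G \<phi> x. \<bar>F y - \<alpha>\<bar> powr p)"
  shows "p_spectral_gap p (schreier_graph G (stabilizer G \<phi> x) S)
           \<le> real (card (orbit G \<phi> x)) * (L powr p * real (card S)) / D"
proof -
  let ?\<Gamma> = "schreier_graph G (stabilizer G \<phi> x) S"
  let ?V = "rcosets (stabilizer G \<phi> x)"
  define \<psi> where "\<psi> A = orb_stab_fun G \<phi> A x" for A
  have bij: "bij_betw \<psi> ?V (orbit G \<phi> x)"
    unfolding \<psi>_def orb_stab_fun_def using x by (rule orbit_stab_fun_is_bij)
  have V: "finite ?V" "card ?V = card (orbit G \<phi> x)"
    using bij orbit by (auto simp: bij_betw_finite bij_betw_same_card)
  have [simp]: "vertices ?\<Gamma> = ?V" "edge_mult ?\<Gamma> A B = card {s \<in> S. A #> s = B}" for A B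
    by (simp_all add: schreier_graph_def)
  have local_energy: "(\<Sum>B | B \<in> ?V \<and> edge_mult ?\<Gamma> A B > 0.
      \<bar>F (\<psi> A) - F (\<psi> B)\<bar> powr p * real (edge_mult ?\<Gamma> A B)) \<le> L powr p * real (card S)"
    if A: "A \<in> ?V" for A
  proof -
    let ?N = "{B \<in> ?V. edge_mult ?\<Gamma> A B > 0}"
    have "(\<Sum>B\<in>?N. \<bar>F (\<psi> A) - F (\<psi> B)\<bar> powr p * real (edge_mult ?\<Gamma> A B))
        \<le> (\<Sum>B\<in>?N. L powr p * real (edge_mult ?\<Gamma> A B))"
    proof (intro sum_mono mult_right_mono powr_mono2 p)
      fix B assume "B \<in> ?N"
      then have "card {s \<in> S. A #> s = B} > 0"
        by simp
      then have "{s \<in> S. A #> s = B} \<noteq> {}"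
        by (metis card.empty less_irrefl)
      then obtain s where s: "s \<in> S" "B = A #> s"
        by auto
      then have "\<psi> B = \<phi> (inv s) (\<psi> A)"
        unfolding \<psi>_def using orb_stab_fun_r_coset[OF x A] S by auto
      moreover have "\<psi> A \<in> orbit G \<phi> x"
        using bij A by (rule bij_betwE[THEN bspec])
      ultimately show "\<bar>F (\<psi> A) - F (\<psi> B)\<bar> \<le> L"
        using lipschitz[of s "\<psi> A"] s by (simp add: abs_minus_commute)
    qed auto
    also have "\<dots> = L powr p * real (\<Sum>B\<in>?N. card {s \<in> S. A #> s = B})"
      by (simp add: sum_distrib_left)
    also have "(\<Sum>B\<in>?N. card {s \<in> S. A #> s = B}) = card (\<Union>B\<in>?N. {s \<in> S. A #> s = B})"
      using V S by (intro card_UN_disjoint[symmetric]) auto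
    also have "L powr p * real \<dots> \<le> L powr p * real (card S)"
      using S by (intro mult_left_mono) (auto intro!: card_mono)
    finally show ?thesis .
  qed
  have "(\<Sum>A\<in>?V. \<Sum>B | B \<in> ?V \<and> edge_mult ?\<Gamma> A B > 0.
      \<bar>F (\<psi> A) - F (\<psi> B)\<bar> powr p * real (edge_mult ?\<Gamma> A B))
      \<le> real (card ?V) * (L powr p * real (card S))"
    using sum_bounded_above[OF local_energy] by simp
  moreover have "D \<le> (\<Sum>A\<in>?V. \<bar>F (\<psi> A) - \<alpha>\<bar> powr p)" for \<alpha>
    using deviation[of \<alpha>] sum.reindex_bij_betw[OF bij, of "\<lambda>y. \<bar>F y - \<alpha>\<bar> powr p"] by simp
  ultimately show ?thesis
    using p_spectral_gap_le[where f = "\<lambda>A. F (\<psi> A)" and \<Gamma> = ?\<Gamma>, OF D] V by simp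
qed

section \<open>The third peg\<close>

text \<open>The three pegs are the residues modulo 3, where distinct \<open>i\<close>, \<open>j\<close> and the remaining peg add
  up to 0. The formula extends this by \<open>third_peg i i = i\<close>, which makes \<open>third_peg c\<close> the
  reflection of the pegs that fixes \<open>c\<close> and swaps the other two.\<close>

definition third_peg :: "3 \<Rightarrow> 3 \<Rightarrow> 3" where
  "third_peg i j = - (i + j)"

lemma pegs_exhaust: "x = 0 \<or> x = 1 \<or> x = 2" for x :: 3
proof -
  have "(UNIV :: 3 set) = {0, 1, 2}"
    by (rule sym, rule card_subset_eq) auto
  then show ?thesis by auto
qed

lemma third_peg_values [simp]:
  "third_peg 0 0 = 0" "third_peg 0 1 = 2" "third_peg 0 2 = 1"
  "third_peg 1 0 = 2" "third_peg 1 1 = 1" "third_peg 1 2 = 0"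
  "third_peg 2 0 = 1" "third_peg 2 1 = 0" "third_peg 2 2 = 2"
  by (simp_all add: third_peg_def)

lemma third_peg_commute: "third_peg i j = third_peg j i"
  by (simp add: third_peg_def)

lemma third_peg_involution: "third_peg c (third_peg c k) = k"
  by (simp add: third_peg_def)

lemma third_peg_eq_iff: "third_peg i j = j \<longleftrightarrow> i = j"
  using pegs_exhaust[of i] pegs_exhaust[of j] by (elim disjE; simp)

lemma third_peg_distrib: "third_peg (third_peg c k) (third_peg c u) = third_peg c (third_peg k u)"
  using pegs_exhaust[of c] pegs_exhaust[of k] pegs_exhaust[of u] by (elim disjE; simp)

lemma eq_third_peg: "i \<noteq> j \<Longrightarrow> x \<noteq> i \<Longrightarrow> x \<noteq> j \<Longrightarrow> x = third_peg i j"
  using pegs_exhaust[of i] pegs_exhaust[of j] pegs_exhaust[of x] by (elim disjE; simp)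

section \<open>Moves seen from the largest disk\<close>

lemma length_hanoi_move [simp]: "length (hanoi_move i j w) = length w"
  by (induction w) auto

lemma hanoi_move_commute: "hanoi_move i j = hanoi_move j i"
proof
  show "hanoi_move i j w = hanoi_move j i w" for w
    by (induction w) auto
qed

lemma hanoi_move_snoc:
  "hanoi_move i j (w @ [u]) =
     (if i \<in> set w \<or> j \<in> set w then hanoi_move i j w @ [u] else w @ hanoi_move i j [u])"
  by (induction w) auto

lemma avoids_two_pegs:
  "i \<noteq> j \<Longrightarrow> i \<notin> set w \<Longrightarrow> j \<notin> set w \<Longrightarrow> w = replicate (length w) (third_peg i j)"
  using replicate_eqI[of w "length w" "third_peg i j"] eq_third_peg[of i j] by metis

section \<open>The distance to a corner\<close>

text \<open>The list starts with the largest disk, that is, it is the reversal of a vertex of the tree.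
  When the largest disk is on its goal \<open>k\<close>, the smaller disks keep this goal, in accordance with
  \<open>third_peg k k = k\<close>. Otherwise they must first gather on the third peg; then the largest disk
  moves, and the \<open>m\<close> smaller ones follow it in \<open>2\<^sup>m - 1\<close> further moves.\<close>

fun corner_dist :: "3 \<Rightarrow> 3 list \<Rightarrow> real" where
  "corner_dist k [] = 0"
| "corner_dist k (u # v) = (if u = k then 0 else 2 ^ length v) + corner_dist (third_peg k u) v"

lemma corner_dist_replicate: "corner_dist k (replicate m x) = (if k = x then 0 else 2 ^ m - 1)"
  by (induction m arbitrary: k) (auto simp: third_peg_eq_iff)

lemma corner_dist_reflect: "corner_dist (third_peg c k) (map (third_peg c) v) = corner_dist k v"
  by (induction v arbitrary: k) (auto simp: third_peg_distrib, (metis third_peg_involution)+)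

text \<open>As long as the largest disk rests, the claim is the one for the smaller disks, with whatever goal
  they have; hence the induction over all goals \<open>k\<close>. The largest disk moves only when all
  smaller disks are on the remaining peg, where the distances are explicit.\<close>

lemma corner_dist_hanoi_move:
  assumes "i \<noteq> j"
  shows "\<bar>corner_dist k (rev (hanoi_move i j w)) - corner_dist k (rev w)\<bar> \<le> 1"
proof (induction w arbitrary: k rule: rev_induct)
  case Nil
  then show ?case by simp
next
  case (snoc u w)
  show ?case
  proof (cases "i \<in> set w \<or> j \<in> set w")
    case True
    then show ?thesis
      using snoc by (simp add: hanoi_move_snoc)
  next
    case False
    define m where "m = length w"
    have w: "w = replicate m (third_peg i j)"
      unfolding m_def using assms False by (intro avoids_two_pegs) auto
    have largest: "\<bar>corner_dist k (rev (w @ [u'])) - corner_dist k (rev (w @ [u]))\<bar> \<le> 1"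
      if "u \<noteq> u'" "third_peg u u' = third_peg i j" for u'
      using that pegs_exhaust[of i] pegs_exhaust[of j] pegs_exhaust[of u] pegs_exhaust[of u']
        pegs_exhaust[of k] assms
      unfolding w by (elim disjE; simp add: corner_dist_replicate)
    consider "u = i" | "u = j" | "u \<noteq> i" "u \<noteq> j"
      by blast
    then show ?thesis
    proof cases
      case 1
      then have "hanoi_move i j (w @ [u]) = w @ [j]"
        using False by (simp add: hanoi_move_snoc)
      with largest[of j] 1 assms show ?thesis
        by simp
    next
      case 2
      then have "hanoi_move i j (w @ [u]) = w @ [i]"
        using False assms by (simp add: hanoi_move_snoc)
      with largest[of i] 2 assms show ?thesis
        by (simp add: third_peg_commute)
    next
      case 3
      then have "hanoi_move i j (w @ [u]) = w @ [u]"
        using False by (simp add: hanoi_move_snoc)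
      then show ?thesis
        by simp
    qed
  qed
qed

text \<open>Match \<open>1 # v\<close> with the word that starts with 0 and goes on with the reflection of \<open>v\<close>
  that swaps 0 and 2. In the first word the smaller disks have the goal 2, in the second one the goal
  0, and the reflection identifies the two remaining tasks. So the distances to the corner 0 differ by
  the summand \<open>2\<^sup>m\<close> alone, and no \<open>\<alpha>\<close> is closer than \<open>2\<^sup>m / 2\<close> to both.\<close>

lemma corner_dist_deviation:
  assumes "0 \<le> p"
  shows "3 ^ m * (2 ^ m / 2) powr p
           \<le> (\<Sum>w | length w = Suc m. \<bar>corner_dist 0 (rev w) - \<alpha>\<bar> powr p)"
proof -
  define h where "h w = \<bar>corner_dist 0 w - \<alpha>\<bar> powr p" for w
  define L where "L = {v :: 3 list. length v = m}"
  define on0 on1 :: "3 list \<Rightarrow> 3 list"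
    where "on0 v = 0 # map (third_peg 1) v" and "on1 v = 1 # v" for v
  have words: "finite {w :: 3 list. length w = n}" "card {w :: 3 list. length w = n} = 3 ^ n" for n
    using finite_lists_length_eq[of "UNIV :: 3 set" n] card_lists_length_eq[of "UNIV :: 3 set" n]
    by simp_all
  have "inj (third_peg 1)"
    by (metis third_peg_involution injI)
  then have inj: "inj_on on0 L" "inj_on on1 L"
    by (auto simp: inj_on_def on0_def on1_def inj_map_eq_map)
  have "(2 ^ m / 2) powr p \<le> h (on0 v) + h (on1 v)" if "v \<in> L" for v
  proof -
    define y where "y = corner_dist 2 v"
    have 0: "corner_dist 0 (on0 v) = y"
      using corner_dist_reflect[of 1 2 v] by (simp add: on0_def y_def)
    have 1: "corner_dist 0 (on1 v) = 2 ^ m + y"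
      using that by (simp add: on1_def y_def L_def)
    have "(2::real) ^ m / 2 \<le> \<bar>y - \<alpha>\<bar> \<or> 2 ^ m / 2 \<le> \<bar>2 ^ m + y - \<alpha>\<bar>"
      by linarith
    then show ?thesis
      unfolding h_def 0 1 using assms
      by (metis (no_types, lifting) add.commute add_increasing powr_ge_zero powr_mono2
          divide_nonneg_nonneg zero_le_numeral zero_le_power)
  qed
  then have "(\<Sum>v\<in>L. (2 ^ m / 2) powr p) \<le> (\<Sum>v\<in>L. h (on0 v) + h (on1 v))"
    by (intro sum_mono)
  then have "3 ^ m * (2 ^ m / 2) powr p \<le> (\<Sum>v\<in>L. h (on0 v)) + (\<Sum>v\<in>L. h (on1 v))"
    by (simp add: sum.distrib L_def words)
  also have "\<dots> = sum h (on0 ` L) + sum h (on1 ` L)"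
    using inj by (simp add: sum.reindex)
  also have "\<dots> = sum h (on0 ` L \<union> on1 ` L)"
    using words by (intro sum.union_disjoint[symmetric]) (auto simp: on0_def on1_def L_def)
  also have "\<dots> \<le> sum h {w. length w = Suc m}"
    using words by (intro sum_mono2) (auto simp: on0_def on1_def L_def h_def)
  also have "\<dots> = (\<Sum>w | length w = Suc m. h (rev w))"
    by (rule sum.reindex_bij_witness[of _ rev rev]) auto
  finally show ?thesis
    by (simp add: h_def)
qed

section \<open>Transitivity of the Hanoi Towers group on words of a given length\<close>

text \<open>Moves between arbitrary pairs of distinct pegs make the arguments symmetric in the pegs; they
  are exactly the generators (\<open>hanoi_gens_eq\<close>).\<close>

definition hanoi_step :: "(3 list \<times> 3 list) set" where
  "hanoi_step = {(w, hanoi_move i j w) | w i j. i \<noteq> j}"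

text \<open>A move of the smaller disks either does nothing or involves one of them, and then an
  additional larger disk does not interfere.\<close>

lemma hanoi_steps_snoc: "(v, w) \<in> hanoi_step\<^sup>* \<Longrightarrow> (v @ [u], w @ [u]) \<in> hanoi_step\<^sup>*"
proof (induction rule: rtrancl_induct)
  case base
  then show ?case by simp
next
  case (step w w')
  then obtain i j where w': "w' = hanoi_move i j w" and "i \<noteq> j"
    by (auto simp: hanoi_step_def)
  have "(w @ [u], w' @ [u]) \<in> hanoi_step\<^sup>*"
  proof (cases "i \<in> set w \<or> j \<in> set w")
    case True
    then have "w' @ [u] = hanoi_move i j (w @ [u])"
      by (simp add: w' hanoi_move_snoc)
    with \<open>i \<noteq> j\<close> show ?thesis
      unfolding hanoi_step_def by (intro r_into_rtrancl) auto
  next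
    case False
    then have "w' = w"
      unfolding w' by (induction w) auto
    then show ?thesis by simp
  qed
  with step.IH show ?case by (rule rtrancl_trans)
qed

text \<open>To move the largest disk from \<open>u\<close> to \<open>u'\<close>, gather all smaller disks on the third peg, and
  distribute them as required afterwards.\<close>

lemma hanoi_steps_connected: "length v = length w \<Longrightarrow> (v, w) \<in> hanoi_step\<^sup>*"
proof (induction v arbitrary: w rule: rev_induct)
  case Nil
  then show ?case by simp
next
  case (snoc u v)
  then obtain w' u' where w: "w = w' @ [u']" and len: "length w' = length v"
    by (cases w rule: rev_cases) auto
  show ?case
  proof (cases "u = u'")
    case True
    then show ?thesis
      using snoc.IH[of w'] len by (simp add: w hanoi_steps_snoc)
  next
    case False
    let ?c = "replicate (length v) (third_peg u u')"
    have "third_peg u u' \<noteq> u" "third_peg u u' \<noteq> u'"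
      using False third_peg_eq_iff by (metis third_peg_commute)+
    then have "hanoi_move u u' (?c @ [u]) = ?c @ [u']"
      by (auto simp: hanoi_move_snoc)
    then have move: "(?c @ [u], ?c @ [u']) \<in> hanoi_step"
      using False unfolding hanoi_step_def by force
    have "(v, ?c) \<in> hanoi_step\<^sup>*" "(v, w') \<in> hanoi_step\<^sup>*"
      using len by (auto intro: snoc.IH)
    have "(?c, w') \<in> hanoi_step\<^sup>*"
    proof -
      have "sym hanoi_step"
        unfolding hanoi_step_def by (rule symI) (auto, metis hanoi_move_involution)
      then have "(?c, v) \<in> hanoi_step\<^sup>*"
        using \<open>(v, ?c) \<in> hanoi_step\<^sup>*\<close> by (meson sym_rtrancl symD)
      then show ?thesis
        using \<open>(v, w') \<in> hanoi_step\<^sup>*\<close> by (rule rtrancl_trans)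
    qed
    then have "(?c @ [u'], w) \<in> hanoi_step\<^sup>*"
      unfolding w by (rule hanoi_steps_snoc)
    moreover have "(v @ [u], ?c @ [u]) \<in> hanoi_step\<^sup>*"
      using \<open>(v, ?c) \<in> hanoi_step\<^sup>*\<close> by (rule hanoi_steps_snoc)
    ultimately show ?thesis
      using move by (meson rtrancl.rtrancl_into_rtrancl rtrancl_trans)
  qed
qed

lemma hanoi_gens_eq: "hanoi_gens = {hanoi_move i j | i j. i \<noteq> j}"
proof -
  have "hanoi_move i j \<in> hanoi_gens" if "i \<noteq> j" for i j
    using that pegs_exhaust[of i] pegs_exhaust[of j] unfolding hanoi_gens_def
    by (elim disjE; simp) (simp_all add: hanoi_move_commute[of 1 0] hanoi_move_commute[of 2 0]
      hanoi_move_commute[of 2 1])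
  moreover have "hanoi_gens \<subseteq> {hanoi_move i j | i j. i \<noteq> j}"
    unfolding hanoi_gens_def by force
  ultimately show ?thesis by auto
qed

lemma hanoi_gens_in_hanoi_group: "hanoi_gens \<subseteq> carrier hanoi_group"
  using hanoi_gens_in_BijGroup unfolding hanoi_group_def carrier_subgroup_generated
  by (auto intro: generate.incl)

lemma group_action_hanoi: "group_action hanoi_group UNIV (\<lambda>g. g)"
proof -
  interpret B: group "BijGroup (UNIV :: 3 list set)"
    by (rule group_BijGroup)
  have "(\<lambda>g. g) \<in> hom hanoi_group (BijGroup UNIV)"
    unfolding hom_def hanoi_group_def using B.carrier_subgroup_generated_subset by auto
  then show ?thesis
    by (simp add: group_action_def group_hom_def group_hom_axioms_def hanoi_group_def
        B.group_axioms)
qed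

lemma inv_BijGroup_hanoi_gens:
  assumes "s \<in> hanoi_gens"
  shows "inv\<^bsub>BijGroup UNIV\<^esub> s = s"
proof -
  interpret B: group "BijGroup (UNIV :: 3 list set)"
    by (rule group_BijGroup)
  have s: "s \<in> carrier (BijGroup UNIV)"
    using assms hanoi_gens_in_BijGroup by auto
  moreover have "s (s w) = w" for w
    using assms by (auto simp: hanoi_gens_eq hanoi_move_involution)
  ultimately have "s \<otimes>\<^bsub>BijGroup UNIV\<^esub> s = \<one>\<^bsub>BijGroup UNIV\<^esub>"
    by (auto simp: BijGroup_def compose_def)
  then show ?thesis
    using s by (intro B.inv_equality)
qed

lemma inv_hanoi_group_gens:
  assumes "s \<in> hanoi_gens"
  shows "inv\<^bsub>hanoi_group\<^esub> s = s"
proof -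
  interpret B: group "BijGroup (UNIV :: 3 list set)"
    by (rule group_BijGroup)
  show ?thesis
    using assms hanoi_gens_in_hanoi_group inv_BijGroup_hanoi_gens
    by (simp add: hanoi_group_def subset_iff)
qed

lemma length_hanoi_group:
  assumes "g \<in> carrier hanoi_group"
  shows "length (g w) = length w"
proof -
  have gens: "length (s v) = length v" if "s \<in> hanoi_gens" for s v
    using that by (auto simp: hanoi_gens_eq)
  interpret B: group "BijGroup (UNIV :: 3 list set)"
    by (rule group_BijGroup)
  have "g \<in> generate (BijGroup UNIV) (carrier (BijGroup UNIV) \<inter> hanoi_gens)"
    using assms by (simp add: hanoi_group_def carrier_subgroup_generated)
  then show ?thesis
  proof (induction arbitrary: w rule: generate.induct)
    case one
    then show ?case by (simp add: BijGroup_def)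
  next
    case (incl s)
    then show ?case by (simp add: gens)
  next
    case (inv s)
    then show ?case by (simp add: gens inv_BijGroup_hanoi_gens)
  next
    case (eng g h)
    then have "g \<in> carrier (BijGroup UNIV)" "h \<in> carrier (BijGroup UNIV)"
      using B.generate_in_carrier by blast+
    then show ?case
      using eng.IH by (simp add: BijGroup_def compose_def)
  qed
qed

lemma hanoi_orbit: "orbit hanoi_group (\<lambda>g. g) v = {w. length w = length v}"
proof (intro subset_antisym subsetI)
  show "w \<in> {w. length w = length v}" if "w \<in> orbit hanoi_group (\<lambda>g. g) v" for w
    using that by (auto simp: orbit_def length_hanoi_group)
next
  interpret group_action hanoi_group UNIV "\<lambda>g. g"
    by (rule group_action_hanoi)
  fix w :: "3 list"
  assume "w \<in> {w. length w = length v}"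
  then have "(v, w) \<in> hanoi_step\<^sup>*"
    by (simp add: hanoi_steps_connected)
  then show "w \<in> orbit hanoi_group (\<lambda>g. g) v"
  proof (induction rule: rtrancl_induct)
    case base
    show ?case by (simp add: orbit_refl)
  next
    case (step w w')
    then obtain s where "s \<in> hanoi_gens" "w' = s w"
      by (auto simp: hanoi_step_def hanoi_gens_eq)
    then have "w' \<in> orbit hanoi_group (\<lambda>g. g) w"
      using hanoi_gens_in_hanoi_group by (auto simp: orbit_def)
    with step.IH show ?case
      using orbit_trans by blast
  qed
qed

section \<open>The spectral gap of the Hanoi graphs\<close>

theorem theorem13:
  fixes p :: real
  assumes "1 \<le> p"
  shows "\<exists>C > 0. \<forall>n::nat. n \<ge> 1 \<longrightarrow>
    p_spectral_gap p (hanoi_schreier_graph n) \<le> C * 2 powr (- (real n * p))"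
proof (intro exI[of _ "9 * 4 powr p"] conjI allI impI)
  show "0 < 9 * 4 powr p" by simp
next
  fix n :: nat
  assume "n \<ge> 1"
  then obtain m where n: "n = Suc m"
    by (cases n) auto
  interpret group_action hanoi_group UNIV "\<lambda>g. g"
    by (rule group_action_hanoi)
  let ?D = "3 ^ m * (2 ^ m / 2) powr p"
  have orbit: "orbit hanoi_group (\<lambda>g. g) (replicate n 1) = {w. length w = n}"
    by (simp add: hanoi_orbit)
  have words: "finite {w :: 3 list. length w = n}" "card {w :: 3 list. length w = n} = 3 ^ n"
    using finite_lists_length_eq[of "UNIV :: 3 set" n] card_lists_length_eq[of "UNIV :: 3 set" n]
    by simp_all
  have lipschitz: "\<bar>corner_dist 0 (rev ((inv\<^bsub>hanoi_group\<^esub> s) w)) - corner_dist 0 (rev w)\<bar> \<le> 1"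
    if "s \<in> hanoi_gens" for s w
    using that corner_dist_hanoi_move
    by (simp add: inv_hanoi_group_gens) (auto simp: hanoi_gens_eq)
  have "p_spectral_gap p (hanoi_schreier_graph n)
      \<le> real (3 ^ n) * (1 powr p * real (card hanoi_gens)) / ?D"
    unfolding hanoi_schreier_graph_def words(2)[symmetric] orbit[symmetric]
  proof (rule schreier_p_spectral_gap_le[where F = "\<lambda>w. corner_dist 0 (rev w)"])
    show "finite (orbit hanoi_group (\<lambda>g. g) (replicate n 1))"
      using words by (simp add: orbit)
    show "finite hanoi_gens"
      by (simp add: hanoi_gens_def)
    show "?D \<le> (\<Sum>w\<in>orbit hanoi_group (\<lambda>g. g) (replicate n 1). \<bar>corner_dist 0 (rev w) - \<alpha>\<bar> powr p)" for \<alpha>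
      using assms corner_dist_deviation[of p m \<alpha>] by (simp add: orbit flip: n)
  qed (use assms hanoi_gens_in_hanoi_group lipschitz in auto)
  also have "\<dots> = 9 / (2 ^ m / 2) powr p"
    by (simp add: card_hanoi_gens n)
  also have "(2 ^ m / 2 :: real) = 2 powr real n / 4"
    by (simp add: n powr_add flip: powr_realpow)
  also have "9 / (2 powr real n / 4) powr p = 9 * 4 powr p * 2 powr (- (real n * p))"
    by (simp add: powr_divide powr_powr powr_minus field_simps)
  finally show "p_spectral_gap p (hanoi_schreier_graph n) \<le> 9 * 4 powr p * 2 powr (- (real n * p))" .
qed

end
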